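(* Let $p$ be a prime. Let $\alpha$ be a linear form on $\mathbb{R}^{n+1}$ such that $\alpha(1,0,\ldots,0) > 0$. Let $f(z,\boldsymbol{x}) = \sum_{(\ell,\boldsymbol{k})\in\mathbb{Z}\times\mathbb{Z}^n} f_{\ell,\boldsymbol{k}} z^\ell \boldsymbol{x}^{\boldsymbol{k}} \in \mathbb{Z}_p[[z^{\pm1}, x_1^{\pm1},\ldots,x_n^{\pm1}]]$ be such that $\alpha(\boldsymbol{w}) > 0$ for all $\boldsymbol{w} \in \operatorname{supp}(f)$. Let $g(z) \in z^r \mathbb{Z}_p[[z]]^\times$ for some integer $r > 0$ (that is, $g = z^r u$ with $u$ a unit of the power series ring $\mathbb{Z}_p[[z]]$). Suppose $f$ satisfies the Gauss congruences for $p$. Then so does the Laurent series \[ F(z,\boldsymbol{x}) = \frac{z g'(z)}{g(z)} f(g(z), \boldsymbol{x}), \] where $f(g(z),\boldsymbol{x}) = \sum f_{\ell,\boldsymbol{k}} g(z)^\ell \boldsymbol{x}^{\boldsymbol{k}}$.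
   Context: $\mathbb{Z}_p[[z^{\pm1},\boldsymbol{x}^{\pm1}]]$ denotes formal sums $\sum_{(\ell,\boldsymbol{k})} f_{\ell,\boldsymbol{k}} z^\ell\boldsymbol{x}^{\boldsymbol{k}}$ with $p$-adic integer coefficients; $\operatorname{supp}(f)$ is the set of exponent vectors $(\ell,\boldsymbol{k})$ with nonzero coefficient. (Under the hypotheses, $f(g(z),\boldsymbol{x})$ is a well-defined formal Laurent series, since only finitely many terms contribute to each coefficient.) A formal Laurent series $h=\sum_{\boldsymbol{j}\in\mathbb{Z}^{n+1}} h_{\boldsymbol{j}}\boldsymbol{w}^{\boldsymbol{j}}$ satisfies the Gauss congruences for the prime $p$ if all $h_{\boldsymbol{j}}\in\mathbb{Z}_p$ and $h_{\boldsymbol{m}p^s}\equiv h_{\boldsymbol{m}p^{s-1}}\pmod{p^s}$ for all $\boldsymbol{m}\in\mathbb{Z}^{n+1}$ and all $s\ge1$. *)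

theory Defs
  imports
    "Jordan_Normal_Form.Matrix"
    "Berlekamp_Zassenhaus.Finite_Field"
    "HOL-Computational_Algebra.Computational_Algebra"
    "HOL-Library.Groups_Big_Fun"
begin

section \<open>The ring of p-adic integers and its field of fractions\<close>

text \<open>
  The prime \<open>p\<close> is the cardinality of the index type \<open>'p\<close> of class \<open>prime_card\<close>, as for the
  type \<open>mod_ring\<close>. A p-adic integer is an element of the inverse limit of the rings of integers
  modulo \<open>p ^ n\<close>, each residue class being represented by its element of \<open>{0..<p ^ n}\<close>.
\<close>

typedef (overloaded) ('p :: prime_card) padic_int =
  "{a :: nat \<Rightarrow> int. \<forall>n. a n \<in> {0..<int CARD('p) ^ n} \<and>
      a (Suc n) mod int CARD('p) ^ n = a n}"
  by (rule exI[of _ "\<lambda>_. 0"]) (simp add: zero_less_card_finite)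

setup_lifting type_definition_padic_int

lemma p_pow_pos: "0 < int CARD('p :: prime_card) ^ n"
  by (simp add: zero_less_card_finite)

lemma mod_p_pow_Suc: "x mod int CARD('p :: prime_card) ^ Suc n mod int CARD('p) ^ n =
    x mod int CARD('p) ^ n"
  by (simp add: mod_mod_cancel)

lemma mod_p_pow_lift:
  assumes "\<And>n. f (Suc n) mod int CARD('p :: prime_card) ^ n = f n mod int CARD('p) ^ n"
  shows "f n mod int CARD('p) ^ n \<in> {0..<int CARD('p) ^ n} \<and>
    f (Suc n) mod int CARD('p) ^ Suc n mod int CARD('p) ^ n = f n mod int CARD('p) ^ n"
  by (simp only: mod_p_pow_Suc assms) (simp add: p_pow_pos)

instantiation padic_int :: (prime_card) comm_ring_1
begin

lift_definition zero_padic_int :: "'a padic_int" is "\<lambda>n. 0 mod int CARD('a) ^ n"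
  by (rule mod_p_pow_lift) simp

lift_definition one_padic_int :: "'a padic_int" is "\<lambda>n. 1 mod int CARD('a) ^ n"
  by (rule mod_p_pow_lift) simp

lift_definition plus_padic_int :: "'a padic_int \<Rightarrow> 'a padic_int \<Rightarrow> 'a padic_int"
  is "\<lambda>a b n. (a n + b n) mod int CARD('a) ^ n"
  by (rule mod_p_pow_lift) (metis mod_add_eq mod_mod_trivial)

lift_definition minus_padic_int :: "'a padic_int \<Rightarrow> 'a padic_int \<Rightarrow> 'a padic_int"
  is "\<lambda>a b n. (a n - b n) mod int CARD('a) ^ n"
  by (rule mod_p_pow_lift) (metis mod_diff_eq mod_mod_trivial)

lift_definition uminus_padic_int :: "'a padic_int \<Rightarrow> 'a padic_int"
  is "\<lambda>a n. (- a n) mod int CARD('a) ^ n"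
  by (rule mod_p_pow_lift) (metis mod_minus_eq mod_mod_trivial)

lift_definition times_padic_int :: "'a padic_int \<Rightarrow> 'a padic_int \<Rightarrow> 'a padic_int"
  is "\<lambda>a b n. (a n * b n) mod int CARD('a) ^ n"
  by (rule mod_p_pow_lift) (metis mod_mult_eq mod_mod_trivial)

instance
proof
  fix a b c :: "'a padic_int"
  show "a * b * c = a * (b * c)"
    by transfer (simp add: mod_mult_left_eq mod_mult_right_eq mult.assoc)
  show "a * b = b * a" by transfer (simp add: mult.commute)
  show "1 * a = a" by transfer (auto simp: mod_mult_left_eq)
  show "a + b + c = a + (b + c)"
    by transfer (simp add: mod_add_left_eq mod_add_right_eq add.assoc)
  show "a + b = b + a" by transfer (simp add: add.commute)
  show "0 + a = a" by transfer auto
  show "- a + a = 0" by transfer (simp add: mod_add_left_eq)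
  show "a - b = a + - b" by transfer (simp add: mod_add_right_eq)
  show "(a + b) * c = a * c + b * c"
    by transfer (simp add: mod_mult_left_eq mod_add_eq distrib_right)
  show "(0 :: 'a padic_int) \<noteq> 1"
  proof transfer
    have "CARD('a) > 1" using prime_card[where 'a = 'a] prime_gt_1_nat by blast
    then have "0 mod int CARD('a) ^ 1 \<noteq> 1 mod int CARD('a) ^ 1" by simp
    then show "(\<lambda>n. 0 mod int CARD('a) ^ n) \<noteq> (\<lambda>n. 1 mod int CARD('a) ^ n)" by metis
  qed
qed

end

lemma padic_coherent:
  assumes "\<forall>n. a n \<in> {0..<int CARD('p :: prime_card) ^ n} \<and>
      a (Suc n) mod int CARD('p) ^ n = a n"
  shows "a (n + k) mod int CARD('p) ^ n = a n"
proof (induction k)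
  case 0
  show ?case using assms by simp
next
  case (Suc k)
  have "a (n + Suc k) mod int CARD('p) ^ n =
      a (Suc (n + k)) mod int CARD('p) ^ (n + k) mod int CARD('p) ^ n"
    by (simp add: mod_mod_cancel le_imp_power_dvd)
  also have "\<dots> = a n" using assms Suc by simp
  finally show ?case .
qed

lemma prime_pow_add_dvd_mult:
  fixes p a b :: int
  assumes "prime p" "p ^ (m + n) dvd a * b"
  shows "p ^ m dvd a \<or> p ^ n dvd b"
proof (cases "a = 0 \<or> b = 0")
  case False
  have "m + n \<le> multiplicity p (a * b)"
    using assms False by (intro multiplicity_geI) auto
  also have "\<dots> = multiplicity p a + multiplicity p b"
    using assms False by (intro prime_elem_multiplicity_mult_distrib) auto
  finally have "m \<le> multiplicity p a \<or> n \<le> multiplicity p b" by linarith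
  then show ?thesis using multiplicity_dvd' by blast
qed auto

instance padic_int :: (prime_card) idom
proof
  fix a b :: "'a padic_int"
  assume "a \<noteq> 0" "b \<noteq> 0"
  then show "a * b \<noteq> 0"
  proof transfer
    let ?p = "int CARD('a)"
    fix a b :: "nat \<Rightarrow> int"
    assume a: "\<forall>n. a n \<in> {0..<?p ^ n} \<and> a (Suc n) mod ?p ^ n = a n"
      and b: "\<forall>n. b n \<in> {0..<?p ^ n} \<and> b (Suc n) mod ?p ^ n = b n"
      and "a \<noteq> (\<lambda>n. 0 mod ?p ^ n)" "b \<noteq> (\<lambda>n. 0 mod ?p ^ n)"
    then obtain m n where mn: "a m \<noteq> 0" "b n \<noteq> 0" by fastforce
    have "\<not> ?p ^ m dvd a (m + n)" using padic_coherent[OF a, of m n] mn by auto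
    moreover have "\<not> ?p ^ n dvd b (m + n)"
      using padic_coherent[OF b, of n m] mn by (auto simp: add.commute)
    ultimately have "\<not> ?p ^ (m + n) dvd a (m + n) * b (m + n)"
      using prime_pow_add_dvd_mult[OF prime_card_int] by blast
    then have "(a (m + n) * b (m + n)) mod ?p ^ (m + n) \<noteq> 0 mod ?p ^ (m + n)" by auto
    then show "(\<lambda>n. a n * b n mod ?p ^ n) \<noteq> (\<lambda>n. 0 mod ?p ^ n)" by metis
  qed
qed

type_synonym 'p padic = "'p padic_int fract"

abbreviation padic_ints :: "('p :: prime_card) padic set"
  where "padic_ints \<equiv> range to_fract"


section \<open>Formal Laurent series in \<open>z, x\<^sub>1, \<dots>, x\<^sub>n\<close>\<close>

text \<open>
  A formal sum of the monomials \<open>z\<^sup>l x\<^sup>k\<close> is given by its coefficients \<open>h l k\<close>, with \<open>l\<close> an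
  integer and \<open>k \<in> carrier_vec n\<close> an integer vector of dimension \<open>n\<close>. Coefficients at vectors
  of another dimension are meaningless and are never referred to.
\<close>

type_synonym 'a zx_series = "int \<Rightarrow> int vec \<Rightarrow> 'a"

definition supp :: "nat \<Rightarrow> ('a :: zero) zx_series \<Rightarrow> (int \<times> int vec) set"
  where "supp n h = {(l, k). k \<in> carrier_vec n \<and> h l k \<noteq> 0}"

definition linear_form :: "nat \<Rightarrow> (real vec \<Rightarrow> real) \<Rightarrow> bool"
  where "linear_form N \<alpha> \<longleftrightarrow>
    (\<forall>v \<in> carrier_vec N. \<forall>w \<in> carrier_vec N. \<alpha> (v + w) = \<alpha> v + \<alpha> w) \<and>
    (\<forall>c. \<forall>v \<in> carrier_vec N. \<alpha> (c \<cdot>\<^sub>v v) = c * \<alpha> v)"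

definition real_exponent :: "int \<Rightarrow> int vec \<Rightarrow> real vec"
  where "real_exponent l k = vCons (real_of_int l) (map_vec real_of_int k)"

definition gauss_congruences :: "nat \<Rightarrow> ('p :: prime_card) padic zx_series \<Rightarrow> bool"
  where "gauss_congruences n h \<longleftrightarrow>
    (\<forall>l. \<forall>k \<in> carrier_vec n. h l k \<in> padic_ints) \<and>
    (\<forall>l. \<forall>k \<in> carrier_vec n. \<forall>s \<ge> 1.
      h (int CARD('p) ^ s * l) (int CARD('p) ^ s \<cdot>\<^sub>v k) -
      h (int CARD('p) ^ (s - 1) * l) (int CARD('p) ^ (s - 1) \<cdot>\<^sub>v k)
        \<in> (\<lambda>c. of_nat CARD('p) ^ s * c) ` padic_ints)"

definition padic_fls :: "('p :: prime_card) padic_int fps \<Rightarrow> 'p padic fls"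
  where "padic_fls g = fps_to_fls (Abs_fps (\<lambda>i. to_fract (fps_nth g i)))"

text \<open>
  The coefficient of \<open>z\<^sup>m x\<^sup>k\<close> in \<open>f(G(z), x)\<close>, that is, in the sum of the series
  \<open>f\<^bsub>l,k\<^esub> G(z)\<^sup>l x\<^sup>k\<close>, and in the product \<open>c(z) h(z, x)\<close>. \<open>Sum_any\<close> adds up the nonzero
  summands if there are finitely many, and is \<open>0\<close> otherwise; lemmas \<open>finite_subst_z\<close>
  and \<open>finite_fls_mult_subst_z\<close> show that the second case does not arise for the series \<open>f\<close>
  supported in an open half-space \<open>\<alpha> > 0\<close> and the \<open>g\<close> considered here.
\<close>

definition subst_z :: "('a :: field) zx_series \<Rightarrow> 'a fls \<Rightarrow> 'a zx_series"
  where "subst_z f G m k = Sum_any (\<lambda>l. f l k * fls_nth (G powi l) m)"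

definition fls_mult_series :: "('a :: field) fls \<Rightarrow> 'a zx_series \<Rightarrow> 'a zx_series"
  where "fls_mult_series c h m k = Sum_any (\<lambda>i. fls_nth c i * h (m - i) k)"

lemma linear_form_real_exponent:
  assumes "linear_form (n + 1) \<alpha>" "k \<in> carrier_vec n"
  shows "\<alpha> (real_exponent l k) = real_of_int l * \<alpha> (unit_vec (n + 1) 0) + \<alpha> (real_exponent 0 k)"
proof -
  have "real_exponent l k = real_of_int l \<cdot>\<^sub>v unit_vec (n + 1) 0 + real_exponent 0 k"
    using assms(2) by (intro eq_vecI) (auto simp: real_exponent_def vec_index_vCons unit_vec_def)
  moreover have "real_of_int l \<cdot>\<^sub>v unit_vec (n + 1) 0 \<in> carrier_vec (n + 1)"
    and "real_exponent 0 k \<in> carrier_vec (n + 1)"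
    and "unit_vec (n + 1) 0 \<in> carrier_vec (n + 1)"
    using assms(2) by (auto simp: real_exponent_def)
  ultimately show ?thesis using assms(1) unfolding linear_form_def by metis
qed

lemma supp_lower_bound:
  assumes "linear_form (n + 1) \<alpha>" "\<alpha> (unit_vec (n + 1) 0) > 0"
    and "\<And>l k. (l, k) \<in> supp n f \<Longrightarrow> \<alpha> (real_exponent l k) > 0" "k \<in> carrier_vec n"
  obtains L where "\<And>l. f l k \<noteq> 0 \<Longrightarrow> L \<le> l"
proof
  fix l assume "f l k \<noteq> 0"
  then have "0 < real_of_int l * \<alpha> (unit_vec (n + 1) 0) + \<alpha> (real_exponent 0 k)"
    using assms linear_form_real_exponent[OF assms(1,4), of l] by (force simp: supp_def)
  then have "- \<alpha> (real_exponent 0 k) / \<alpha> (unit_vec (n + 1) 0) < real_of_int l"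
    using assms(2) by (simp add: field_simps)
  then show "\<lfloor>- \<alpha> (real_exponent 0 k) / \<alpha> (unit_vec (n + 1) 0)\<rfloor> \<le> l" by linarith
qed

lemma padic_fls_nth_eq_0:
  assumes "u dvd 1" "g = fps_X ^ r * u" "i < int r"
  shows "fls_nth (padic_fls g) i = 0"
  using assms by (auto simp: padic_fls_def fps_X_power_mult_nth)

lemma padic_fls_subdegree:
  assumes "u dvd 1" "g = fps_X ^ r * u"
  shows "fls_subdegree (padic_fls g) = int r"
proof (rule fls_subdegree_eqI)
  obtain v where "u * v = 1" using assms(1) by (metis dvdE)
  then have "fps_nth u 0 * fps_nth v 0 = 1" by (metis fps_mult_nth_0 fps_one_nth)
  then have "fps_nth u 0 \<noteq> 0" by auto
  then show "fls_nth (padic_fls g) (int r) \<noteq> 0"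
    using assms(2) by (simp add: padic_fls_def fps_X_power_mult_nth)
qed (use padic_fls_nth_eq_0[OF assms] in auto)

lemma finite_subst_z:
  assumes "linear_form (n + 1) \<alpha>" "\<alpha> (unit_vec (n + 1) 0) > 0"
    and "\<And>l k. (l, k) \<in> supp n f \<Longrightarrow> \<alpha> (real_exponent l k) > 0" "k \<in> carrier_vec n"
    and "u dvd 1" "g = fps_X ^ r * u" "r > 0"
  shows "finite {l. to_fract (f l k) * fls_nth (padic_fls g powi l) m \<noteq> 0}"
proof -
  obtain L where L: "\<And>l. f l k \<noteq> 0 \<Longrightarrow> L \<le> l" using supp_lower_bound[OF assms(1-4)] by blast
  have "{l. to_fract (f l k) * fls_nth (padic_fls g powi l) m \<noteq> 0} \<subseteq> {L..max 0 m}"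
  proof
    fix l assume *: "l \<in> {l. to_fract (f l k) * fls_nth (padic_fls g powi l) m \<noteq> 0}"
    then have "fls_subdegree (padic_fls g powi l) \<le> m" by (intro fls_subdegree_leI) auto
    then have "l * int r \<le> m" using padic_fls_subdegree[OF assms(5,6)] by simp
    moreover have "l \<le> l * int r" if "l > 0" using that assms(7) by simp
    ultimately have "l \<le> max 0 m" by linarith
    moreover have "L \<le> l" using L * by auto
    ultimately show "l \<in> {L..max 0 m}" by simp
  qed
  then show ?thesis using finite_subset by blast
qed

lemma finite_fls_mult_subst_z:
  assumes "linear_form (n + 1) \<alpha>" "\<alpha> (unit_vec (n + 1) 0) > 0"
    and "\<And>l k. (l, k) \<in> supp n f \<Longrightarrow> \<alpha> (real_exponent l k) > 0" "k \<in> carrier_vec n"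
    and "u dvd 1" "g = fps_X ^ r * u"
  shows "finite {i. fls_nth c i * subst_z (\<lambda>l k. to_fract (f l k)) (padic_fls g) (m - i) k \<noteq> 0}"
proof -
  obtain L where L: "\<And>l. f l k \<noteq> 0 \<Longrightarrow> L \<le> l" using supp_lower_bound[OF assms(1-4)] by blast
  have bound: "L * int r \<le> j"
    if nz: "subst_z (\<lambda>l k. to_fract (f l k)) (padic_fls g) j k \<noteq> 0" for j
  proof -
    obtain l where l: "to_fract (f l k) * fls_nth (padic_fls g powi l) j \<noteq> 0"
      using nz unfolding subst_z_def by (metis (no_types, lifting) Sum_any.not_neutral_obtains_not_neutral)
    then have "fls_subdegree (padic_fls g powi l) \<le> j" by (intro fls_subdegree_leI) auto
    then have "l * int r \<le> j" using padic_fls_subdegree[OF assms(5,6)] by simp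
    moreover have "L * int r \<le> l * int r" using L[of l] l by (auto intro: mult_right_mono)
    ultimately show ?thesis by linarith
  qed
  have "{i. fls_nth c i * subst_z (\<lambda>l k. to_fract (f l k)) (padic_fls g) (m - i) k \<noteq> 0}
      \<subseteq> {fls_subdegree c..m - L * int r}"
    using bound by (force intro: fls_subdegree_leI)
  then show ?thesis using finite_subset by blast
qed

end

theory Submission
  imports Defs
begin

text \<open>
  Put \<open>\<theta> = z d/dz\<close>, \<open>\<phi> = \<theta> g / g\<close> and \<open>a\<^sub>l(m) = [z\<^sup>m] \<phi> g\<^sup>l\<close>, so that the coefficient of \<open>z\<^sup>m x\<^sup>k\<close> in
  \<open>F\<close> is the finite sum of the \<open>f\<^bsub>l,k\<^esub> a\<^sub>l(m)\<close>. From \<open>\<theta>(g\<^sup>l) = l \<phi> g\<^sup>l\<close> one gets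
  \<open>l a\<^sub>l(m) = m [z\<^sup>m] g\<^sup>l\<close>. By Frobenius \<open>g(z)\<^sup>p = W(z) g(z\<^sup>p)\<close> with \<open>W \<equiv> 1\<close> modulo \<open>p\<close>, hence
  \<open>W\<^sup>l \<equiv> 1\<close> modulo \<open>p l\<close>, and comparing coefficients gives \<open>a\<^bsub>pl\<^esub>(pm) \<equiv> a\<^sub>l(m)\<close> modulo \<open>p m\<close>.
  By the Gauss congruences for \<open>f\<close> and the divisibility of \<open>l a\<^sub>l(m)\<close> by \<open>m\<close>, the terms of \<open>F\<close> at
  \<open>(pm, pk)\<close> whose index is \<open>p l\<close> are congruent to the terms at \<open>(m, k)\<close> with index \<open>l\<close>, and those whose index is prime to \<open>p\<close> vanish modulo \<open>p m\<close>.
\<close>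

section \<open>Multiples of powers of p\<close>

definition padic_multiples :: "nat \<Rightarrow> ('p :: prime_card) padic set"
  \<comment> \<open>This is the ideal p^s Z_p inside the fraction field, spelled exactly as in
    \<open>gauss_congruences\<close> so that it can be folded there.\<close>
  where "padic_multiples s = (\<lambda>c. of_nat CARD('p) ^ s * c) ` padic_ints"

section \<open>Divisibility by p in Z_p and Fermat's little theorem\<close>

lemma Rep_padic_int_of_nat:
  "Rep_padic_int (of_nat k :: 'p :: prime_card padic_int) n = int k mod int CARD('p) ^ n"
  by (induction k)
    (simp_all add: zero_padic_int.rep_eq one_padic_int.rep_eq plus_padic_int.rep_eq mod_simps)

lemma of_nat_CARD_padic_neq_0: "(of_nat CARD('p) :: 'p :: prime_card padic_int) \<noteq> 0"
proof
  assume "(of_nat CARD('p) :: 'p padic_int) = 0"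
  \<comment> \<open>Level 1 does not distinguish p from 0; level 2 is the first that does.\<close>
  then have "int CARD('p) mod int CARD('p) ^ 2 = 0"
    using Rep_padic_int_of_nat[of "CARD('p)" 2, where 'p = 'p]
    by (simp add: zero_padic_int.rep_eq)
  then have "CARD('p) ^ 2 dvd CARD('p)" by (metis dvd_eq_mod_eq_0 int_dvd_int_iff of_nat_power)
  moreover have "CARD('p) > 1" using prime_card[where 'a = 'p] prime_gt_1_nat by blast
  ultimately show False by (auto dest!: dvd_imp_le simp: power2_eq_square)
qed

text \<open>By coherence a vanishing residue modulo p makes every residue of positive level
  divisible by p, and the quotients again form a coherent sequence.\<close>

lemma of_nat_CARD_dvd_padic_intI:
  fixes c :: "'p :: prime_card padic_int"
  assumes "Rep_padic_int c 1 = 0"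
  shows "of_nat CARD('p) dvd c"
proof -
  let ?p = "int CARD('p)"
  define a where "a = Rep_padic_int c"
  have a: "\<forall>n. a n \<in> {0..<?p ^ n} \<and> a (Suc n) mod ?p ^ n = a n"
    using Rep_padic_int[of c] by (simp add: a_def)
  have p: "?p > 0" using p_pow_pos[of 1, where 'p = 'p] by simp
  have dvd: "?p dvd a (Suc n)" for n
    using padic_coherent[OF a, of 1 n] assms by (auto simp: a_def)
  \<comment> \<open>Dividing by p costs one level of precision, hence the shifted index.\<close>
  define b where "b n = a (Suc n) div ?p" for n
  have ab: "a (Suc n) = ?p * b n" for n using dvd[of n] by (simp add: b_def)
  have "b n \<in> {0..<?p ^ n} \<and> b (Suc n) mod ?p ^ n = b n" for n
  proof -
    have "?p * b n \<ge> 0" "?p * b n < ?p * ?p ^ n" using a ab[of n] by (metis atLeastLessThan_iff power_Suc)+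
    moreover have "?p * (b (Suc n) mod ?p ^ n) = ?p * b n"
      using a ab by (metis mult_mod_right power_Suc)
    ultimately show ?thesis using p by (auto simp: zero_le_mult_iff)
  qed
  then have b: "Rep_padic_int (Abs_padic_int b :: 'p padic_int) = b"
    by (intro Abs_padic_int_inverse) auto
  have "Rep_padic_int (of_nat CARD('p) * (Abs_padic_int b :: 'p padic_int)) = a"
  proof
    fix n
    have "Rep_padic_int (of_nat CARD('p) * (Abs_padic_int b :: 'p padic_int)) n =
        ?p * b n mod ?p ^ n"
      by (simp add: times_padic_int.rep_eq b Rep_padic_int_of_nat mod_simps)
    also have "\<dots> = a n" using a ab[of n] by metis
    finally show "Rep_padic_int (of_nat CARD('p) * (Abs_padic_int b :: 'p padic_int)) n = a n" .
  qed
  then have "of_nat CARD('p) * Abs_padic_int b = c"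
    by (simp add: a_def Rep_padic_int_inject)
  then show ?thesis by (metis dvdI)
qed

lemma Rep_padic_int_power:
  "Rep_padic_int ((c :: 'p :: prime_card padic_int) ^ k) n = Rep_padic_int c n ^ k mod int CARD('p) ^ n"
  by (induction k) (simp_all add: one_padic_int.rep_eq times_padic_int.rep_eq mod_simps)

text \<open>Divisibility by p is decided by the residue at level 1, where the ordinary Fermat
  theorem for integers applies.\<close>

lemma padic_int_fermat:
  fixes c :: "'p :: prime_card padic_int"
  shows "of_nat CARD('p) dvd c ^ CARD('p) - c"
proof (rule of_nat_CARD_dvd_padic_intI)
  let ?p = "CARD('p)"
  have p: "prime ?p" by (rule prime_card)
  have "Rep_padic_int c 1 \<ge> 0" using Rep_padic_int[of c] by auto
  then obtain a where a: "Rep_padic_int c 1 = int a" using nonneg_int_cases by blast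
  have "[a ^ ?p = a] (mod ?p)"
  proof (cases "?p dvd a")
    case True
    then show ?thesis using p
      by (metis cong_0_iff cong_sym cong_trans dvd_power_same dvd_trans dvd_power prime_gt_0_nat)
  next
    case False
    then have "[a ^ (?p - 1) * a = 1 * a] (mod ?p)" by (intro cong_mult fermat_theorem p) auto
    then show ?thesis using p by (metis mult_1 power_minus_mult prime_gt_0_nat)
  qed
  then have "(int a ^ ?p) mod int ?p = int a mod int ?p"
    by (metis cong_def of_nat_mod of_nat_power)
  then show "Rep_padic_int (c ^ ?p - c) 1 = 0"
    by (simp add: minus_padic_int.rep_eq Rep_padic_int_power a[simplified] mod_diff_left_eq mod_eq_dvd_iff)
qed

section \<open>Passage to the fraction field and the ideals p^s Z_p\<close>

lemma to_fract_of_nat [simp]: "to_fract (of_nat k) = of_nat k"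
  by (induction k) simp_all

lemma to_fract_of_int [simp]: "to_fract (of_int k) = of_int k"
  by (cases k) (simp_all del: of_nat_Suc)

lemma to_fract_power [simp]: "to_fract (x ^ k) = to_fract x ^ k"
  by (induction k) simp_all

lemma of_nat_CARD_padic_field_neq_0 [simp]: "(of_nat CARD('p) :: 'p :: prime_card padic) \<noteq> 0"
  using of_nat_CARD_padic_neq_0[where 'p = 'p] by (metis to_fract_eq_0_iff to_fract_of_nat)

lemma padic_multiples_iff:
  "x \<in> padic_multiples s \<longleftrightarrow> (\<exists>c. x = of_nat CARD('p) ^ s * to_fract (c :: 'p :: prime_card padic_int))"
  by (auto simp: padic_multiples_def)

lemma padic_ints_eq_multiples: "padic_ints = padic_multiples 0"
  by (auto simp: padic_multiples_def)

lemma padic_multiples_0 [simp]: "0 \<in> padic_multiples s"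
  by (auto simp: padic_multiples_iff intro: exI[of _ 0])

lemma padic_multiples_add: "x \<in> padic_multiples s \<Longrightarrow> y \<in> padic_multiples s \<Longrightarrow> x + y \<in> padic_multiples s"
  by (auto simp: padic_multiples_iff simp flip: distrib_left to_fract_add)

lemma padic_multiples_diff: "x \<in> padic_multiples s \<Longrightarrow> y \<in> padic_multiples s \<Longrightarrow> x - y \<in> padic_multiples s"
  by (auto simp: padic_multiples_iff simp flip: right_diff_distrib to_fract_diff)

lemma padic_multiples_sum:
  "(\<And>i. i \<in> A \<Longrightarrow> F i \<in> padic_multiples s) \<Longrightarrow> sum F A \<in> padic_multiples s"
  by (induction A rule: infinite_finite_induct) (auto intro: padic_multiples_add)

lemma padic_multiples_mult:
  fixes x y :: "'p :: prime_card padic"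
  assumes "x \<in> padic_multiples s" "y \<in> padic_multiples t"
  shows "x * y \<in> padic_multiples (s + t)"
proof -
  obtain c d where "x = of_nat CARD('p) ^ s * to_fract c" "y = of_nat CARD('p) ^ t * to_fract d"
    using assms by (auto simp: padic_multiples_iff)
  then have "x * y = of_nat CARD('p) ^ (s + t) * to_fract (c * d)"
    by (simp add: power_add)
  then show ?thesis unfolding padic_multiples_iff by blast
qed

lemma padic_multiples_of_int:
  assumes "int CARD('p :: prime_card) ^ s dvd m"
  shows "(of_int m :: 'p padic) \<in> padic_multiples s"
proof -
  obtain c where "m = int CARD('p) ^ s * c" using assms by blast
  then have "(of_int m :: 'p padic) = of_nat CARD('p) ^ s * to_fract (of_int c)" by simp
  then show ?thesis unfolding padic_multiples_iff by blast
qed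

lemma padic_multiples_mono: "s \<le> t \<Longrightarrow> x \<in> padic_multiples t \<Longrightarrow> x \<in> padic_multiples s"
  for x :: "'p :: prime_card padic"
proof -
  assume "s \<le> t" "x \<in> padic_multiples t"
  then obtain c where "x = of_nat CARD('p) ^ t * to_fract c" by (auto simp: padic_multiples_iff)
  then have "x = of_nat CARD('p) ^ s * to_fract (of_nat CARD('p) ^ (t - s) * c)"
    using \<open>s \<le> t\<close> by (simp flip: power_add mult.assoc)
  then show ?thesis unfolding padic_multiples_iff by blast
qed

text \<open>Write l = p^v b with b prime to p. The factor p^v cancels in the field, and b is
  invertible modulo p^s by Bezout; integrality of \<open>a\<close> absorbs the Bezout term
  containing p^s.\<close>

lemma padic_multiples_cancel:
  fixes a :: "'p :: prime_card padic"
  assumes "of_int l * a \<in> padic_multiples (multiplicity (int CARD('p)) l + s)"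
    and "l \<noteq> 0" "a \<in> padic_multiples 0"
  shows "a \<in> padic_multiples s"
proof -
  let ?p = "int CARD('p)"
  have p: "prime ?p" by (rule prime_card_int)
  define v where "v = multiplicity ?p l"
  obtain b where l: "l = ?p ^ v * b" and "\<not> ?p dvd b"
    using multiplicity_decompose'[of l ?p] assms(2) p unfolding v_def
    by (metis not_prime_unit)
  then have "coprime b (?p ^ s)"
    using p by (metis coprime_commute coprime_power_right_iff prime_imp_coprime)
  then obtain x y where xy: "x * b + y * ?p ^ s = 1"
    using bezout_int[of b "?p ^ s"] by auto
  obtain c where "of_int l * a = of_nat CARD('p) ^ (v + s) * to_fract c"
    using assms(1) by (auto simp: padic_multiples_iff v_def)
  then have "of_nat CARD('p) ^ v * (of_int b * a) = of_nat CARD('p) ^ v * (of_nat CARD('p) ^ s * to_fract c)"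
    by (simp add: l power_add mult.assoc)
  then have "of_int b * a = of_nat CARD('p) ^ s * to_fract c" by simp
  then have ba: "of_int b * a \<in> padic_multiples s" by (auto simp: padic_multiples_iff)
  have "a = of_int (x * b + y * ?p ^ s) * a" by (simp add: xy)
  also have "\<dots> = of_int x * (of_int b * a) + of_int (y * ?p ^ s) * a"
    by (simp add: algebra_simps)
  also have "\<dots> \<in> padic_multiples s"
    using padic_multiples_mult[OF padic_multiples_of_int ba, of 0 x]
      padic_multiples_mult[OF padic_multiples_of_int assms(3), of s "y * ?p ^ s"]
    by (intro padic_multiples_add) auto
  finally show ?thesis .
qed

section \<open>Laurent series with coefficients divisible by a power of p\<close>

definition fls_multiples :: "nat \<Rightarrow> ('p :: prime_card) padic fls set"
  where "fls_multiples s = {X. \<forall>i. fls_nth X i \<in> padic_multiples s}"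

lemma fls_multiplesD: "X \<in> fls_multiples s \<Longrightarrow> fls_nth X i \<in> padic_multiples s"
  by (simp add: fls_multiples_def)

lemma fls_multiples_0 [simp]: "0 \<in> fls_multiples s"
  by (simp add: fls_multiples_def)

lemma fls_multiples_add: "X \<in> fls_multiples s \<Longrightarrow> Y \<in> fls_multiples s \<Longrightarrow> X + Y \<in> fls_multiples s"
  by (simp add: fls_multiples_def padic_multiples_add)

lemma fls_multiples_diff: "X \<in> fls_multiples s \<Longrightarrow> Y \<in> fls_multiples s \<Longrightarrow> X - Y \<in> fls_multiples s"
  by (simp add: fls_multiples_def padic_multiples_diff)

lemma fls_multiples_sum:
  "(\<And>i. i \<in> A \<Longrightarrow> F i \<in> fls_multiples s) \<Longrightarrow> sum F A \<in> fls_multiples s"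
  by (induction A rule: infinite_finite_induct) (auto intro: fls_multiples_add)

lemma fls_multiples_mono: "s \<le> t \<Longrightarrow> X \<in> fls_multiples t \<Longrightarrow> X \<in> fls_multiples s"
  by (simp add: fls_multiples_def padic_multiples_mono[of s t])

lemma fls_multiples_mult:
  assumes "X \<in> fls_multiples s" "Y \<in> fls_multiples t"
  shows "X * Y \<in> fls_multiples (s + t)"
  unfolding fls_multiples_def fls_times_nth(2) mem_Collect_eq
  by (intro allI padic_multiples_sum padic_multiples_mult fls_multiplesD assms)

lemma fls_multiples_const: "c \<in> padic_multiples s \<Longrightarrow> fls_const c \<in> fls_multiples s"
  by (simp add: fls_multiples_def)

lemma fls_multiples_of_int:
  "int CARD('p) ^ s dvd m \<Longrightarrow> (of_int m :: 'p :: prime_card padic fls) \<in> fls_multiples s"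
  by (simp add: fls_of_int fls_multiples_const padic_multiples_of_int)

lemma fls_multiples_of_nat:
  assumes "CARD('p) ^ s dvd m"
  shows "(of_nat m :: 'p :: prime_card padic fls) \<in> fls_multiples s"
proof -
  have "int CARD('p) ^ s dvd int m" by (metis assms of_nat_dvd_iff of_nat_power)
  from fls_multiples_of_int[OF this] show ?thesis by simp
qed

lemma fls_multiples_power:
  assumes "X \<in> fls_multiples s"
  shows "X ^ k \<in> fls_multiples (k * s)"
proof (induction k)
  case 0
  show ?case using fls_multiples_of_int[of 0 1] by simp
next
  case (Suc k)
  then show ?case using fls_multiples_mult[OF assms] by simp
qed

lemma fls_multiples_deriv:
  assumes "X \<in> fls_multiples s"
  shows "fls_deriv X \<in> fls_multiples s"
proof -
  have "of_int (i + 1) * fls_nth X (i + 1) \<in> padic_multiples (0 + s)" for i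
    by (intro padic_multiples_mult padic_multiples_of_int fls_multiplesD assms) simp
  then show ?thesis by (simp add: fls_multiples_def)
qed

lemma fls_multiples_X: "fls_X \<in> fls_multiples 0"
  using padic_multiples_of_int[of 0 1] by (simp add: fls_multiples_def)

lemma fls_multiples_compose_power:
  "d > 0 \<Longrightarrow> X \<in> fls_multiples s \<Longrightarrow> fls_compose_power X d \<in> fls_multiples s"
  by (simp add: fls_multiples_def fls_nth_compose_power)

section \<open>The Frobenius congruence for power series\<close>

lemma fls_freshmans_dream:
  fixes X Y :: "'p :: prime_card padic fls"
  assumes "X \<in> fls_multiples 0" "Y \<in> fls_multiples 0"
  shows "(X + Y) ^ CARD('p) - X ^ CARD('p) - Y ^ CARD('p) \<in> fls_multiples 1"
proof -
  let ?p = "CARD('p)"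
  have p: "prime ?p" by (rule prime_card)
  \<comment> \<open>Separates the two outer terms of the binomial sum; the inner binomial
    coefficients are divisible by p.\<close>
  have eq: "{..?p} = insert 0 (insert ?p {0<..<?p})" using p prime_gt_0_nat by force
  have "(X + Y) ^ ?p = (\<Sum>k\<le>?p. of_nat (?p choose k) * X ^ k * Y ^ (?p - k))"
    by (rule binomial_ring)
  also have "\<dots> = Y ^ ?p + X ^ ?p + (\<Sum>k\<in>{0<..<?p}. of_nat (?p choose k) * X ^ k * Y ^ (?p - k))"
    using p prime_gt_0_nat unfolding eq by (subst sum.insert; force)+
  finally have "(X + Y) ^ ?p - X ^ ?p - Y ^ ?p =
      (\<Sum>k\<in>{0<..<?p}. of_nat (?p choose k) * (X ^ k * Y ^ (?p - k)))"
    by (simp add: mult.assoc)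
  also have "\<dots> \<in> fls_multiples 1"
  proof (intro fls_multiples_sum)
    fix k assume "k \<in> {0<..<?p}"
    then have "(of_nat (?p choose k) :: 'p padic fls) \<in> fls_multiples 1"
      using p by (intro fls_multiples_of_nat) (auto intro!: dvd_choose_prime)
    moreover have "X ^ k * Y ^ (?p - k) \<in> fls_multiples 0"
      using fls_multiples_mult[OF fls_multiples_power[OF assms(1)] fls_multiples_power[OF assms(2)]]
      by simp
    ultimately show "of_nat (?p choose k) * (X ^ k * Y ^ (?p - k)) \<in> fls_multiples 1"
      using fls_multiples_mult by fastforce
  qed
  finally show ?thesis .
qed

text \<open>The congruence is proved for coefficients below N by induction on N, for all series at
  once. With x = c + z y, the binomial theorem modulo p and Fermat for c leave z^p times the same
  difference for y.\<close>

lemma fps_frobenius: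
  fixes x :: "'p :: prime_card padic fps"
  assumes "fps_to_fls x \<in> fls_multiples 0"
  shows "fps_to_fls x ^ CARD('p) - fls_compose_power (fps_to_fls x) CARD('p) \<in> fls_multiples 1"
proof -
  let ?p = "CARD('p)"
  have p: "prime ?p" by (rule prime_card)
  have "\<forall>i < int N. fls_nth (fps_to_fls x ^ ?p - fls_compose_power (fps_to_fls x) ?p) i \<in> padic_multiples 1"
    for N using assms
  proof (induction N arbitrary: x)
    \<comment> \<open>Only negative indices occur here, and both series have zero coefficients
      there.\<close>
    case 0
    show ?case
      by (auto simp: fls_nth_compose_power div_less_dividend pos_imp_zdiv_neg_iff
          zero_less_card_finite simp flip: fps_to_fls_power)
  next
    case (Suc N)
    define c where "c = fps_nth x 0"
    define y where "y = fps_shift 1 x"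
    define X where "X = fps_to_fls x"
    define Y where "Y = fps_to_fls y"
    have c: "c \<in> padic_multiples 0"
      using fls_multiplesD[OF Suc.prems, of 0] by (simp add: c_def)
    have "fls_nth Y i \<in> padic_multiples 0" for i
      using fls_multiplesD[OF Suc.prems, of "i + 1"] by (cases "i < 0") (simp_all add: Y_def y_def nat_add_distrib)
    then have Y: "Y \<in> fls_multiples 0" by (simp add: fls_multiples_def)
    have "x = fps_const c + fps_X * y"
      by (rule fps_ext) (auto simp: c_def y_def)
    then have X: "X = fls_const c + fls_X * Y"
      by (simp add: X_def Y_def fls_plus_const fls_times_fps_to_fls fps_to_fls_plus fps_const_to_fls)
    have comp: "fls_compose_power X ?p = fls_const c + fls_X_intpow (int ?p) * fls_compose_power Y ?p"
      unfolding X using p prime_gt_0_nat by simp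
    define E where "E = X ^ ?p - fls_const c ^ ?p - (fls_X * Y) ^ ?p"
    have "fls_X * Y \<in> fls_multiples 0"
      using fls_multiples_mult[OF fls_multiples_X Y] by simp
    then have E: "E \<in> fls_multiples 1" unfolding E_def X
      using fls_freshmans_dream fls_multiples_const c by blast
    have "fls_X ^ ?p = (fls_X_intpow (int ?p) :: 'p padic fls)"
      by (simp add: fls_X_power_conv_shift_1)
    then have eq: "X ^ ?p - fls_compose_power X ?p =
        E + fls_const (c ^ ?p - c) + fls_X_intpow (int ?p) * (Y ^ ?p - fls_compose_power Y ?p)"
      unfolding comp E_def
      by (simp add: power_mult_distrib right_diff_distrib fls_const_power flip: fls_minus_const)
    obtain c' where "c = to_fract c'" using c by (auto simp: padic_multiples_iff)
    then have "c ^ ?p - c = to_fract (c' ^ ?p - c')" by simp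
    moreover obtain d where "c' ^ ?p - c' = of_nat CARD('p) * d"
      using padic_int_fermat[of c'] by blast
    ultimately have "c ^ ?p - c = of_nat CARD('p) ^ 1 * to_fract d" by simp
    then have "c ^ ?p - c \<in> padic_multiples 1" unfolding padic_multiples_iff by blast
    then have "fls_const (c ^ ?p - c) \<in> fls_multiples 1" by (rule fls_multiples_const)
    note const = this
    show ?case unfolding X_def[symmetric]
    proof (intro allI impI)
      fix i assume "i < int (Suc N)"
      \<comment> \<open>The factor z^p lowers the index by p, which is at least 1, so the hypothesis
        for N applies to \<open>y\<close>.\<close>
      then have "i - int ?p < int N" using prime_gt_0_nat[OF p] by linarith
      then have "fls_nth (Y ^ ?p - fls_compose_power Y ?p) (i - int ?p) \<in> padic_multiples 1"
        using Suc.IH[of y] Y unfolding Y_def by blast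
      then show "fls_nth (X ^ ?p - fls_compose_power X ?p) i \<in> padic_multiples 1"
        unfolding eq fls_plus_nth fls_X_intpow_times_conv_shift fls_shift_nth
        by (intro padic_multiples_add fls_multiplesD[OF E] fls_multiplesD[OF const]) simp
    qed
  qed
  moreover have "i < int (Suc (nat i))" for i by linarith
  ultimately show ?thesis unfolding fls_multiples_def by blast
qed

section \<open>Powers of integral series that are congruent to 1 modulo p\<close>

lemma fls_multiples_mult_left:
  "X \<in> fls_multiples 0 \<Longrightarrow> Y \<in> fls_multiples s \<Longrightarrow> X * Y \<in> fls_multiples s"
  using fls_multiples_mult[of X 0 Y s] by simp

lemma fls_multiples_power_0: "X \<in> fls_multiples 0 \<Longrightarrow> X ^ k \<in> fls_multiples 0"
  using fls_multiples_power[of X 0 k] by simp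

lemma fls_multiples_power_int:
  assumes "X \<in> fls_multiples 0" "inverse X \<in> fls_multiples 0"
  shows "X powi l \<in> fls_multiples 0"
  using assms by (simp add: power_int_def fls_multiples_power_0)

lemma of_nat_CARD_fls_neq_0: "(of_nat CARD('p) :: 'p :: prime_card padic fls) \<noteq> 0"
  by (simp add: fls_of_nat)

lemma fls_multiples_1E:
  fixes X :: "'p :: prime_card padic fls"
  assumes "X \<in> fls_multiples 1"
  obtains h where "h \<in> fls_multiples 0" "X = of_nat CARD('p) * h"
proof
  let ?P = "of_nat CARD('p) :: 'p padic"
  show "fls_const (1 / ?P) * X \<in> fls_multiples 0"
    unfolding fls_multiples_def mem_Collect_eq
  proof
    fix i
    obtain c where "fls_nth X i = ?P * to_fract c"
      using fls_multiplesD[OF assms, of i] by (auto simp: padic_multiples_iff)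
    then have "fls_nth (fls_const (1 / ?P) * X) i = ?P ^ 0 * to_fract c" by simp
    then show "fls_nth (fls_const (1 / ?P) * X) i \<in> padic_multiples 0"
      unfolding padic_multiples_iff by blast
  qed
  show "X = of_nat CARD('p) * (fls_const (1 / ?P) * X)"
    by (rule fls_eqI) (simp add: fls_of_nat)
qed

lemma fls_power_minus_1_multiples:
  assumes "X \<in> fls_multiples 0" "X - 1 \<in> fls_multiples s"
  shows "X ^ k - 1 \<in> fls_multiples s"
proof -
  have "X ^ k - 1 = (\<Sum>i<k. X ^ i) * (X - 1)" by (simp add: power_diff_1_eq)
  also have "\<dots> \<in> fls_multiples s"
    by (intro fls_multiples_mult_left fls_multiples_sum fls_multiples_power_0 assms)
  finally show ?thesis .
qed

text \<open>In X^p - 1 = (X - 1)(1 + X + ... + X^(p-1)) the second factor is congruent to p, hence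
  to 0, modulo p; this gains one power of p.\<close>

lemma fls_power_CARD_minus_1_multiples:
  fixes X :: "'p :: prime_card padic fls"
  assumes X: "X \<in> fls_multiples 0" "X - 1 \<in> fls_multiples s" and s: "s \<ge> 1"
  shows "X ^ CARD('p) - 1 \<in> fls_multiples (Suc s)"
proof -
  have "X ^ i - 1 \<in> fls_multiples 1" for i
    using fls_multiples_mono[OF s] fls_power_minus_1_multiples[OF X] by blast
  then have "(\<Sum>i<CARD('p). X ^ i - 1) + of_nat CARD('p) \<in> fls_multiples 1"
    by (intro fls_multiples_add fls_multiples_sum fls_multiples_of_nat) auto
  then have "(\<Sum>i<CARD('p). X ^ i) \<in> fls_multiples 1" by (simp add: sum_subtractf)
  from fls_multiples_mult[OF this X(2)] show ?thesis by (simp add: power_diff_1_eq mult.commute)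
qed

lemma fls_power_CARD_power_minus_1_multiples:
  fixes X :: "'p :: prime_card padic fls"
  assumes "X \<in> fls_multiples 0" "X - 1 \<in> fls_multiples 1"
  shows "X ^ (CARD('p) ^ v) - 1 \<in> fls_multiples (Suc v)"
proof (induction v)
  case 0
  show ?case using assms by simp
next
  case (Suc v)
  have "(X ^ (CARD('p) ^ v)) ^ CARD('p) - 1 \<in> fls_multiples (Suc (Suc v))"
    using Suc by (intro fls_power_CARD_minus_1_multiples fls_multiples_power_0 assms) auto
  then show ?case by (metis power_Suc2 power_mult)
qed

text \<open>Each factor p of the exponent gains one power of p. Negative exponents reduce to
  positive ones for \<open>inverse X\<close>, which is also congruent to 1 modulo p.\<close>

lemma fls_power_int_minus_1_multiples:
  fixes X :: "'p :: prime_card padic fls"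
  assumes X: "X \<in> fls_multiples 0" "X - 1 \<in> fls_multiples 1" and X': "inverse X \<in> fls_multiples 0"
    and X0: "X \<noteq> 0" and l: "int CARD('p) ^ v dvd l"
  shows "X powi l - 1 \<in> fls_multiples (Suc v)"
proof -
  obtain q where q: "l = int (CARD('p) ^ v) * q" using l by auto
  have *: "Y ^ nat j - 1 \<in> fls_multiples (Suc v)"
    if "Y \<in> fls_multiples 0" "Y - 1 \<in> fls_multiples 1" "j = int (CARD('p) ^ v) * i" "i \<ge> 0"
    for Y :: "'p padic fls" and i j
  proof -
    have "nat j = CARD('p) ^ v * nat i" using that(3,4) by (simp add: nat_mult_distrib nat_power_eq)
    then show ?thesis
      using fls_power_minus_1_multiples[OF fls_multiples_power_0[OF that(1)]
          fls_power_CARD_power_minus_1_multiples[OF that(1,2)]] by (simp add: power_mult)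
  qed
  show ?thesis
  proof (cases "q \<ge> 0")
    case True
    then have "l \<ge> 0" by (simp add: q)
    then show ?thesis using *[OF X q True] by (simp add: power_int_def)
  next
    case False
    then have "l \<le> 0" by (simp add: q mult_nonneg_nonpos)
    then have eq: "X powi l = inverse X ^ nat (- l)"
      by (cases "l = 0") (simp_all add: power_int_def)
    have "inverse X - 1 = 0 - inverse X * (X - 1)" using X0 by (simp add: algebra_simps)
    also have "\<dots> \<in> fls_multiples 1"
      by (intro fls_multiples_diff fls_multiples_mult_left X' X) simp
    finally show ?thesis using *[OF X', of "- l" "- q"] False q unfolding eq by simp
  qed
qed

section \<open>The Euler derivation and logarithmic derivatives\<close>

definition fls_euler :: "'a :: comm_ring_1 fls \<Rightarrow> 'a fls"
  where "fls_euler X = fls_X * fls_deriv X"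

text \<open>For X = g this is the factor z g'/g of the theorem.\<close>

definition fls_log_euler :: "'a :: field fls \<Rightarrow> 'a fls"
  where "fls_log_euler X = fls_euler X / X"

lemma fls_euler_nth [simp]: "fls_nth (fls_euler X) i = of_int i * fls_nth X i"
  by (simp add: fls_euler_def fls_X_times_conv_shift)

lemma fls_euler_mult: "fls_euler (X * Y) = X * fls_euler Y + fls_euler X * Y"
  by (simp add: fls_euler_def algebra_simps)

lemma fls_euler_power_Suc: "fls_euler (X ^ Suc n) = of_nat (Suc n) * (X ^ n * fls_euler X)"
  by (simp only: fls_euler_def fls_deriv_power) (simp add: algebra_simps)

lemma fls_euler_compose_power:
  assumes "d > 0"
  shows "fls_euler (fls_compose_power X d) = of_nat d * fls_compose_power (fls_euler X) d"
  by (rule fls_eqI) (auto simp: fls_nth_compose_power assms fls_of_nat)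

lemma fls_multiples_euler: "X \<in> fls_multiples s \<Longrightarrow> fls_euler X \<in> fls_multiples s"
  unfolding fls_euler_def by (intro fls_multiples_mult_left fls_multiples_X fls_multiples_deriv)

lemma fls_log_euler_mult:
  "X \<noteq> 0 \<Longrightarrow> Y \<noteq> 0 \<Longrightarrow> fls_log_euler (X * Y) = fls_log_euler X + fls_log_euler Y"
  by (simp add: fls_log_euler_def fls_euler_mult add_divide_distrib)

lemma fls_log_euler_1 [simp]: "fls_log_euler 1 = 0"
  by (simp add: fls_log_euler_def fls_euler_def)

lemma fls_log_euler_power: "X \<noteq> 0 \<Longrightarrow> fls_log_euler (X ^ n) = of_nat n * fls_log_euler X"
  by (induction n) (simp_all add: fls_log_euler_mult algebra_simps)

lemma fls_log_euler_inverse: "X \<noteq> 0 \<Longrightarrow> fls_log_euler (inverse X) = - fls_log_euler X"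
  using fls_log_euler_mult[of X "inverse X"] by (simp add: eq_neg_iff_add_eq_0 add.commute)

lemma fls_log_euler_power_int:
  "X \<noteq> 0 \<Longrightarrow> fls_log_euler (X powi l) = of_int l * fls_log_euler X"
  by (auto simp: power_int_def fls_log_euler_power fls_log_euler_inverse)

section \<open>The substitution z -> z^d\<close>

lemma fls_compose_power_inverse:
  fixes X :: "'a :: field fls"
  assumes "X \<noteq> 0" "d > 0"
  shows "fls_compose_power (inverse X) d = inverse (fls_compose_power X d)"
proof -
  have "fls_compose_power X d * fls_compose_power (inverse X) d = 1"
    using assms by (simp flip: fls_compose_power_mult)
  then show ?thesis by (metis inverse_unique)
qed

lemma fls_compose_power_power_int:
  fixes X :: "'a :: field fls"
  assumes "X \<noteq> 0" "d > 0"
  shows "fls_compose_power (X powi l) d = fls_compose_power X d powi l"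
  by (simp add: power_int_def fls_compose_power_inverse assms)

text \<open>Chain rule. For d = p the factor d matches the p coming from the logarithmic derivative
  of g^p, so that p can be cancelled in \<open>twisted_coeff_cong_zero\<close>.\<close>

lemma fls_log_euler_compose_power:
  fixes X :: "'a :: field fls"
  assumes "X \<noteq> 0" "d > 0"
  shows "fls_log_euler (fls_compose_power X d) = of_nat d * fls_compose_power (fls_log_euler X) d"
  by (simp add: fls_log_euler_def divide_inverse fls_euler_compose_power fls_compose_power_inverse assms)

section \<open>Congruences for the powers of an integral unit series\<close>

context
  fixes x :: "'p :: prime_card padic fps" and G :: "'p padic fls"
  assumes G_def: "G = fps_to_fls x" and G_neq_0: "G \<noteq> 0"
    and G: "G \<in> fls_multiples 0" and G': "inverse G \<in> fls_multiples 0"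
begin

text \<open>This is the series W with g(z)^p = W(z) g(z^p).\<close>

definition frobenius_quotient :: "'p padic fls"
  where "frobenius_quotient = G ^ CARD('p) / fls_compose_power G CARD('p)"

lemma compose_power_G_neq_0: "fls_compose_power G CARD('p) \<noteq> 0"
proof -
  have "inverse (fls_compose_power G CARD('p)) * fls_compose_power G CARD('p) = 1"
    using G_neq_0 by (simp add: zero_less_card_finite flip: fls_compose_power_inverse fls_compose_power_mult)
  then show ?thesis by auto
qed

lemma frobenius_quotient_neq_0: "frobenius_quotient \<noteq> 0"
  using G_neq_0 compose_power_G_neq_0 by (simp add: frobenius_quotient_def)

lemma G_power_CARD: "G ^ CARD('p) = frobenius_quotient * fls_compose_power G CARD('p)"
  using compose_power_G_neq_0 by (simp add: frobenius_quotient_def)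

lemma inverse_compose_power_G: "inverse (fls_compose_power G CARD('p)) \<in> fls_multiples 0"
  using fls_multiples_compose_power[OF _ G', of "CARD('p)"] G_neq_0
  by (simp add: fls_compose_power_inverse zero_less_card_finite)

lemma frobenius_quotient_multiples: "frobenius_quotient \<in> fls_multiples 0"
  unfolding frobenius_quotient_def divide_inverse
  by (intro fls_multiples_mult_left fls_multiples_power_0 G inverse_compose_power_G)

lemma inverse_frobenius_quotient_multiples: "inverse frobenius_quotient \<in> fls_multiples 0"
proof -
  have "inverse frobenius_quotient = fls_compose_power G CARD('p) * inverse G ^ CARD('p)"
    by (simp add: frobenius_quotient_def field_simps)
  then show ?thesis
    by (simp add: fls_multiples_mult_left fls_multiples_power_0 fls_multiples_compose_power G G' zero_less_card_finite)
qed

text \<open>This is the Frobenius congruence divided by g(z^p), whose inverse is integral.\<close>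

lemma frobenius_quotient_minus_1: "frobenius_quotient - 1 \<in> fls_multiples 1"
proof -
  have "frobenius_quotient - 1 =
      inverse (fls_compose_power G CARD('p)) * (G ^ CARD('p) - fls_compose_power G CARD('p))"
    using compose_power_G_neq_0 by (simp add: frobenius_quotient_def field_simps)
  then show ?thesis
    using fps_frobenius[of x] G inverse_compose_power_G by (simp add: fls_multiples_mult_left G_def)
qed

text \<open>The l-th power of g(z)^p = W(z) g(z^p) differs from g(z^p)^l by the factor W^l, which is
  congruent to 1 modulo p^(v+1).\<close>

lemma power_int_G_cong:
  assumes "int CARD('p) ^ v dvd l"
  shows "G powi (int CARD('p) * l) - fls_compose_power (G powi l) CARD('p) \<in> fls_multiples (Suc v)"
proof -
  let ?C = "fls_compose_power (G powi l) CARD('p)"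
  have "G powi (int CARD('p) * l) = (G ^ CARD('p)) powi l" by (simp add: power_int_mult)
  also have "\<dots> = frobenius_quotient powi l * ?C"
    using G_neq_0
    by (simp add: G_power_CARD power_int_mult_distrib fls_compose_power_power_int zero_less_card_finite)
  finally have "G powi (int CARD('p) * l) - ?C = ?C * (frobenius_quotient powi l - 1)"
    by (simp add: algebra_simps)
  also have "\<dots> \<in> fls_multiples (Suc v)"
    using assms
    by (intro fls_multiples_mult_left fls_multiples_compose_power fls_multiples_power_int G G'
        fls_power_int_minus_1_multiples frobenius_quotient_multiples frobenius_quotient_minus_1
        inverse_frobenius_quotient_multiples frobenius_quotient_neq_0) (simp_all add: zero_less_card_finite)
  finally show ?thesis .
qed

lemma log_euler_G_multiples: "fls_log_euler G \<in> fls_multiples 0"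
  unfolding fls_log_euler_def divide_inverse
  by (intro fls_multiples_mult_left fls_multiples_euler G G')

text \<open>These are the numbers a_l(m) of the overview.\<close>

definition twisted_coeff :: "int \<Rightarrow> int \<Rightarrow> 'p padic"
  where "twisted_coeff l m = fls_nth (fls_log_euler G * G powi l) m"

lemma twisted_coeff_multiples_0: "twisted_coeff l m \<in> padic_multiples 0"
  unfolding twisted_coeff_def
  by (intro fls_multiplesD fls_multiples_mult_left log_euler_G_multiples fls_multiples_power_int G G')

text \<open>Both sides are the coefficient of z^m in theta(g^l): the left one through the
  logarithmic derivative, the right one directly.\<close>

lemma of_int_mult_twisted_coeff:
  "of_int l * twisted_coeff l m = of_int m * fls_nth (G powi l) m"
proof -
  have "fls_euler (G powi l) = of_int l * (fls_log_euler G * G powi l)"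
    using fls_log_euler_power_int[OF G_neq_0, of l] G_neq_0
    by (simp add: fls_log_euler_def field_simps)
  then have "fls_nth (fls_euler (G powi l)) m = of_int l * twisted_coeff l m"
    by (simp add: twisted_coeff_def fls_of_int)
  then show ?thesis by simp
qed

text \<open>Since m divides l a_l(m), the powers of p in m not absorbed by l remain. If l absorbs
  them all, the truncated difference is 0 and integrality is enough.\<close>

lemma twisted_coeff_multiples:
  assumes "int CARD('p) ^ s dvd m" "l \<noteq> 0"
  shows "twisted_coeff l m \<in> padic_multiples (s - multiplicity (int CARD('p)) l)"
proof (cases "multiplicity (int CARD('p)) l \<le> s")
  case True
  have "of_int m * fls_nth (G powi l) m \<in> padic_multiples (s + 0)"
    by (intro padic_multiples_mult padic_multiples_of_int assms fls_multiplesD fls_multiples_power_int G G')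
  then show ?thesis
    using True assms(2)
    by (intro padic_multiples_cancel[OF _ _ twisted_coeff_multiples_0, of l])
      (simp_all add: of_int_mult_twisted_coeff)
qed (simp add: twisted_coeff_multiples_0)

text \<open>After multiplication by l both terms become m times coefficients of powers of g, which
  agree modulo p^(v+1) for v the p-adic valuation of l. Dividing by l then costs exactly v
  powers.\<close>

lemma twisted_coeff_cong_nonzero:
  assumes m: "int CARD('p) ^ s dvd m" and l: "l \<noteq> 0"
  shows "twisted_coeff (int CARD('p) * l) (int CARD('p) * m) - twisted_coeff l m
    \<in> padic_multiples (Suc s)"
proof -
  let ?p = "int CARD('p)" and ?v = "multiplicity (int CARD('p)) l"
  have "(of_nat CARD('p) :: 'p padic) * (of_int l * twisted_coeff (?p * l) (?p * m)) =
      of_nat CARD('p) * (of_int m * fls_nth (G powi (?p * l)) (?p * m))"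
    using of_int_mult_twisted_coeff[of "?p * l" "?p * m"] by (simp add: mult.assoc)
  then have "of_int l * twisted_coeff (?p * l) (?p * m) = of_int m * fls_nth (G powi (?p * l)) (?p * m)"
    by simp
  \<comment> \<open>The coefficient of z^(pm) in X(z^p) is that of z^m in X.\<close>
  moreover have "fls_nth (fls_compose_power (G powi l) CARD('p)) (?p * m) = fls_nth (G powi l) m"
    by (simp add: fls_nth_compose_power zero_less_card_finite)
  ultimately have eq: "of_int l * (twisted_coeff (?p * l) (?p * m) - twisted_coeff l m) =
      of_int m * fls_nth (G powi (?p * l) - fls_compose_power (G powi l) CARD('p)) (?p * m)"
    by (simp add: right_diff_distrib of_int_mult_twisted_coeff)
  have "\<dots> \<in> padic_multiples (s + Suc ?v)"
    by (intro padic_multiples_mult padic_multiples_of_int m fls_multiplesD power_int_G_cong multiplicity_dvd)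
  then have "of_int l * (twisted_coeff (?p * l) (?p * m) - twisted_coeff l m)
      \<in> padic_multiples (?v + Suc s)" unfolding eq by (simp add: add.commute)
  then show ?thesis
    using l by (rule padic_multiples_cancel) (intro padic_multiples_diff twisted_coeff_multiples_0)
qed

text \<open>
  For \<open>l = 0\<close> the division by \<open>l\<close> is unavailable; the difference is the logarithmic derivative
  of \<open>1 + p h\<close>, whose coefficients are controlled by expanding \<open>1 / (1 + p h)\<close> geometrically.
\<close>

lemma twisted_coeff_cong_zero:
  assumes m: "int CARD('p) ^ s dvd m"
  shows "twisted_coeff 0 (int CARD('p) * m) - twisted_coeff 0 m \<in> padic_multiples (Suc s)"
proof -
  let ?p = "int CARD('p)" and ?P = "of_nat CARD('p) :: 'p padic fls" and ?W = frobenius_quotient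
  obtain h where h: "h \<in> fls_multiples 0" "?W - 1 = ?P * h"
    using fls_multiples_1E[OF frobenius_quotient_minus_1] .
  then have W: "?W = 1 + ?P * h" by (simp add: algebra_simps)
  have "fls_euler ?P = 0" by (simp add: fls_euler_def)
  then have euler_W: "fls_euler ?W = ?P * fls_euler h"
    by (simp add: W fls_euler_mult) (simp add: fls_euler_def)
  \<comment> \<open>Logarithmic derivatives of both sides of g(z)^p = W(z) g(z^p); every term
    carries a factor p.\<close>
  have "?P * fls_log_euler G = fls_log_euler (G ^ CARD('p))"
    using G_neq_0 by (simp add: fls_log_euler_power)
  also have "\<dots> = fls_log_euler ?W + ?P * fls_compose_power (fls_log_euler G) CARD('p)"
    using G_neq_0 compose_power_G_neq_0 frobenius_quotient_neq_0
    by (simp add: G_power_CARD fls_log_euler_mult fls_log_euler_compose_power zero_less_card_finite)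
  also have "fls_log_euler ?W = ?P * (fls_euler h / ?W)"
    by (simp add: fls_log_euler_def euler_W)
  finally have "?P * (fls_log_euler G - fls_compose_power (fls_log_euler G) CARD('p)) =
      ?P * (fls_euler h / ?W)" by (simp add: algebra_simps)
  then have diff: "fls_log_euler G - fls_compose_power (fls_log_euler G) CARD('p) = fls_euler h / ?W"
    using of_nat_CARD_fls_neq_0 by (metis mult_left_cancel)

  \<comment> \<open>With W = 1 - q, the inverse of W is expanded to s + 1 terms with exact remainder
    q^N / W, which is already divisible by p^(s+1).\<close>
  define q where "q = - (?P * h)"
  define N where "N = Suc s"
  have "1 - q ^ N = ?W * (\<Sum>j<N. q ^ j)"
    using one_diff_power_eq[of q N] by (simp add: q_def W)
  then have inv: "1 / ?W = (\<Sum>j<N. q ^ j) + q ^ N * inverse ?W"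
    using frobenius_quotient_neq_0 by (simp add: field_simps)
  have "fls_euler h / ?W = (1 / ?W) * fls_euler h" by simp
  then have expand: "fls_euler h / ?W =
      (\<Sum>j<N. q ^ j * fls_euler h) + q ^ N * (inverse ?W * fls_euler h)"
    unfolding inv by (simp add: distrib_right sum_distrib_right mult.assoc)
  have "- 1 \<in> (fls_multiples 0 :: 'p padic fls set)" using fls_multiples_of_int[of 0 "- 1"] by simp
  then have "- 1 * h * ?P \<in> fls_multiples 1"
    using h by (intro fls_multiples_mult_left fls_multiples_of_nat) (simp_all add: fls_multiples_mult_left)
  then have q: "q \<in> fls_multiples 1" by (simp add: q_def mult.commute)
  have "q ^ N * (inverse ?W * fls_euler h) \<in> fls_multiples (N * 1 + 0)"
    by (intro fls_multiples_mult fls_multiples_power q fls_multiples_mult_left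
        inverse_frobenius_quotient_multiples fls_multiples_euler h)
  then have last: "fls_nth (q ^ N * (inverse ?W * fls_euler h)) (?p * m) \<in> padic_multiples (Suc s)"
    using fls_multiplesD by (simp add: N_def)
  have q_power_eq: "q ^ j = fls_const ((- of_nat CARD('p)) ^ j) * h ^ j" for j
    by (simp add: q_def fls_of_nat fls_const_power flip: power_mult_distrib)
  \<comment> \<open>Up to the factor (-p)^j the term is h^j theta(h) = theta(h^(j+1)) / (j+1). Its
    coefficient at pm is divisible by pm except for the p-part of j+1, and p^j compensates that
    loss.\<close>
  have main: "fls_nth (q ^ j * fls_euler h) (?p * m) \<in> padic_multiples (Suc s)" for j
  proof -
    let ?c = "fls_nth (h ^ j * fls_euler h) (?p * m)" and ?d = "(- of_nat CARD('p)) ^ j :: 'p padic"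
    have "fls_nth (fls_euler (h ^ Suc j)) (?p * m) = of_nat (Suc j) * ?c"
      unfolding fls_euler_power_Suc by (simp only: fls_of_nat fls_mult_const_nth)
    then have "of_int (int (Suc j)) * ?c = of_int (?p * m) * fls_nth (h ^ Suc j) (?p * m)"
      by (simp del: power_Suc of_nat_Suc)
    then have eq: "of_int (int (Suc j)) * (?d * ?c) = ?d * (of_int (?p * m) * fls_nth (h ^ Suc j) (?p * m))"
      by (simp only: mult.left_commute[of "of_int (int (Suc j))" ?d ?c])
    have "(of_int ((- ?p) ^ j) :: 'p padic) \<in> padic_multiples j"
      by (intro padic_multiples_of_int) (simp add: dvd_power_same)
    then have d: "?d \<in> padic_multiples j" by simp
    have "?d * (of_int (?p * m) * fls_nth (h ^ Suc j) (?p * m)) \<in> padic_multiples (j + (Suc s + 0))"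
      using m by (intro padic_multiples_mult d padic_multiples_of_int fls_multiplesD fls_multiples_power_0 h)
        simp
    \<comment> \<open>If e is this multiplicity, then e < p^e \<le> j + 1.\<close>
    moreover have "multiplicity ?p (int (Suc j)) \<le> j"
    proof -
      let ?e = "multiplicity ?p (int (Suc j))"
      have "?p ^ ?e dvd int (Suc j)" by (rule multiplicity_dvd)
      then have "CARD('p) ^ ?e dvd Suc j" by (metis of_nat_dvd_iff of_nat_power)
      then have "CARD('p) ^ ?e \<le> Suc j" by (rule dvd_imp_le) simp
      moreover have "?e < CARD('p) ^ ?e"
        using prime_card[where 'a = 'p] prime_gt_1_nat by (intro power_gt_expt) auto
      ultimately show ?thesis by simp
    qed
    ultimately have "of_int (int (Suc j)) * (?d * ?c)
        \<in> padic_multiples (multiplicity ?p (int (Suc j)) + Suc s)"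
      unfolding eq by (elim padic_multiples_mono[rotated]) simp
    moreover have "?d * ?c \<in> padic_multiples (j + 0)"
      by (intro padic_multiples_mult d fls_multiplesD fls_multiples_mult_left fls_multiples_power_0
          fls_multiples_euler h)
    then have "?d * ?c \<in> padic_multiples 0" by (elim padic_multiples_mono[rotated]) simp
    ultimately have "?d * ?c \<in> padic_multiples (Suc s)"
      using padic_multiples_cancel[of "int (Suc j)" "?d * ?c" "Suc s"] by simp
    then show ?thesis by (simp add: q_power_eq mult.assoc)
  qed
  have "twisted_coeff 0 (?p * m) - twisted_coeff 0 m =
      fls_nth (fls_log_euler G - fls_compose_power (fls_log_euler G) CARD('p)) (?p * m)"
    by (simp add: twisted_coeff_def fls_nth_compose_power zero_less_card_finite)
  also have "\<dots> = (\<Sum>j<N. fls_nth (q ^ j * fls_euler h) (?p * m)) +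
      fls_nth (q ^ N * (inverse ?W * fls_euler h)) (?p * m)"
    unfolding diff expand by (simp add: fls_nth_sum)
  also have "\<dots> \<in> padic_multiples (Suc s)"
    by (intro padic_multiples_add padic_multiples_sum main last)
  finally show ?thesis .
qed

lemma twisted_coeff_cong:
  assumes "int CARD('p) ^ s dvd m"
  shows "twisted_coeff (int CARD('p) * l) (int CARD('p) * m) - twisted_coeff l m
    \<in> padic_multiples (Suc s)"
  using twisted_coeff_cong_nonzero[OF assms, of l] twisted_coeff_cong_zero[OF assms]
  by (cases "l = 0") simp_all

end

section \<open>The substitution\<close>

lemma to_fract_sum: "to_fract (sum F A) = (\<Sum>i\<in>A. to_fract (F i))"
  by (induction A rule: infinite_finite_induct) simp_all

lemma padic_fls_mult: "padic_fls (a * b) = padic_fls a * padic_fls b"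
proof -
  have "Abs_fps (\<lambda>i. to_fract (fps_nth (a * b) i)) =
      Abs_fps (\<lambda>i. to_fract (fps_nth a i)) * Abs_fps (\<lambda>i. to_fract (fps_nth b i))"
    by (rule fps_ext) (simp add: fps_mult_nth to_fract_sum)
  then show ?thesis by (simp add: padic_fls_def fls_times_fps_to_fls)
qed

lemma padic_fls_1 [simp]: "padic_fls 1 = 1"
proof -
  have "Abs_fps (\<lambda>i. to_fract (fps_nth 1 i)) = 1" by (rule fps_ext) simp
  then show ?thesis by (simp add: padic_fls_def)
qed

lemma padic_fls_X [simp]: "padic_fls (fps_X :: 'a :: prime_card padic_int fps) = fls_X"
proof -
  have "Abs_fps (\<lambda>i. to_fract (fps_nth (fps_X :: 'a padic_int fps) i)) = fps_X" by (rule fps_ext) simp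
  then have "padic_fls (fps_X :: 'a padic_int fps) = fps_to_fls fps_X" by (simp only: padic_fls_def)
  then show ?thesis by simp
qed

lemma padic_fls_power: "padic_fls (a ^ k) = padic_fls a ^ k"
  by (induction k) (simp_all add: padic_fls_mult)

lemma padic_fls_multiples: "padic_fls a \<in> fls_multiples 0"
  using padic_ints_eq_multiples by (auto simp: fls_multiples_def padic_fls_def)

text \<open>The inverse is z^(-r) v, where v is the inverse of u in Z_p[[z]].\<close>

lemma inverse_padic_fls_multiples:
  fixes u :: "'p :: prime_card padic_int fps"
  assumes "u dvd 1"
  shows "inverse (padic_fls (fps_X ^ r * u)) \<in> fls_multiples 0"
proof -
  obtain v where "1 = u * v" using assms by (rule dvdE)
  then have uv: "padic_fls u * padic_fls v = 1" by (metis padic_fls_mult padic_fls_1)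
  have "(fls_X_inv :: 'p padic fls) \<in> fls_multiples 0"
    using padic_multiples_of_int[of 0 1] by (simp add: fls_multiples_def)
  then have "fls_X_inv ^ r * padic_fls v \<in> fls_multiples 0"
    by (intro fls_multiples_mult_left fls_multiples_power_0 padic_fls_multiples)
  moreover have "(fls_X ^ r * fls_X_inv ^ r :: 'p padic fls) = 1"
    by (simp add: fls_X_times_conv_shift flip: power_mult_distrib)
  then have "padic_fls (fps_X ^ r * u) * (fls_X_inv ^ r * padic_fls v) = 1"
    using uv by (simp add: padic_fls_mult padic_fls_power algebra_simps)
  then have "inverse (padic_fls (fps_X ^ r * u)) = fls_X_inv ^ r * padic_fls v"
    by (rule inverse_unique)
  ultimately show ?thesis by simp
qed

text \<open>Interchanges the sum over l with the Cauchy product by \<open>c\<close>. Only exponents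
  j up to m minus the order of \<open>c\<close> meet a nonzero coefficient of \<open>c\<close>, so
  \<open>A\<close> has to catch just the l that contribute there.\<close>

lemma fls_mult_series_subst_z_eq_sum:
  fixes F :: "'a :: field zx_series"
  assumes A: "finite A"
    and supp: "\<And>l j. F l k \<noteq> 0 \<Longrightarrow> j \<le> m - fls_subdegree c \<Longrightarrow> fls_nth (G powi l) j \<noteq> 0 \<Longrightarrow> l \<in> A"
  shows "fls_mult_series c (subst_z F G) m k = (\<Sum>l\<in>A. F l k * fls_nth (c * G powi l) m)"
proof -
  \<comment> \<open>A common lower bound for the orders of the powers; the inserted 0 keeps the set
    nonempty when \<open>A\<close> is empty.\<close>
  define D where "D = Min (insert 0 ((\<lambda>l. fls_subdegree (G powi l)) ` A))"
  have D: "D \<le> fls_subdegree (G powi l)" if "l \<in> A" for l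
    unfolding D_def using that A by (intro Min_le) auto
  define B where "B = {fls_subdegree c..m - D}"
  have subst: "subst_z F G (m - i) k = (\<Sum>l\<in>A. F l k * fls_nth (G powi l) (m - i))"
    if "fls_nth c i \<noteq> 0" for i
  proof -
    have "fls_subdegree c \<le> i" using that by (rule fls_subdegree_leI)
    then have "{l. F l k * fls_nth (G powi l) (m - i) \<noteq> 0} \<subseteq> A"
      using supp[of _ "m - i"] by auto
    then show ?thesis unfolding subst_z_def using A by (rule Sum_any.expand_superset[rotated])
  qed
  \<comment> \<open>Where the coefficient of \<open>c\<close> vanishes, \<open>subst\<close> says
    nothing, but both sides are 0.\<close>
  have eq: "fls_nth c i * subst_z F G (m - i) k =
      (\<Sum>l\<in>A. F l k * (fls_nth c i * fls_nth (G powi l) (m - i)))" for i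
    by (cases "fls_nth c i = 0") (simp_all add: subst sum_distrib_left mult.left_commute)
  have zero: "fls_nth (G powi l) (m - i) = 0" if "l \<in> A" "i > m - fls_subdegree (G powi l)" for l i
    using that(2) by (intro fls_eq0_below_subdegree) linarith
  have "{i. fls_nth c i * subst_z F G (m - i) k \<noteq> 0} \<subseteq> B"
  proof
    fix i assume i: "i \<in> {i. fls_nth c i * subst_z F G (m - i) k \<noteq> 0}"
    then have "fls_subdegree c \<le> i" by (intro fls_subdegree_leI) auto
    moreover have "i \<le> m - D"
    proof (rule ccontr)
      assume *: "\<not> i \<le> m - D"
      have "fls_nth (G powi l) (m - i) = 0" if "l \<in> A" for l
        using zero[OF that, of i] D[OF that] * by linarith
      then show False using i unfolding mem_Collect_eq eq by simp
    qed
    ultimately show "i \<in> B" by (simp add: B_def)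
  qed
  moreover have "finite B" by (simp add: B_def)
  ultimately have "fls_mult_series c (subst_z F G) m k =
      (\<Sum>i\<in>B. fls_nth c i * subst_z F G (m - i) k)"
    unfolding fls_mult_series_def by (intro Sum_any.expand_superset)
  also have "\<dots> = (\<Sum>l\<in>A. F l k * (\<Sum>i\<in>B. fls_nth c i * fls_nth (G powi l) (m - i)))"
    unfolding eq sum_distrib_left by (rule sum.swap)
  also have "\<dots> = (\<Sum>l\<in>A. F l k * fls_nth (c * G powi l) m)"
  proof (intro sum.cong refl arg_cong2[where f = "(*)"])
    fix l assume l: "l \<in> A"
    show "(\<Sum>i\<in>B. fls_nth c i * fls_nth (G powi l) (m - i)) = fls_nth (c * G powi l) m"
      unfolding fls_times_nth(2)
      using D[OF l] zero[OF l] by (intro sum.mono_neutral_right) (auto simp: B_def)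
  qed
  finally show ?thesis .
qed

text \<open>Shifting \<open>s\<close> by one and turning the multiple of p^s in the z-exponent into
  a divisibility condition gives the same shape as \<open>twisted_coeff_cong\<close>.\<close>

lemma gauss_congruences_iff:
  fixes h :: "'p :: prime_card padic zx_series"
  shows "gauss_congruences n h \<longleftrightarrow>
    (\<forall>l. \<forall>k \<in> carrier_vec n. h l k \<in> padic_multiples 0) \<and>
    (\<forall>s l. \<forall>k \<in> carrier_vec n. int CARD('p) ^ s dvd l \<longrightarrow>
      h (int CARD('p) * l) (int CARD('p) \<cdot>\<^sub>v (int CARD('p) ^ s \<cdot>\<^sub>v k)) - h l (int CARD('p) ^ s \<cdot>\<^sub>v k)
        \<in> padic_multiples (Suc s))" (is "_ \<longleftrightarrow> ?int \<and> ?cong")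
proof -
  let ?p = "int CARD('p)"
  have "(\<forall>l. \<forall>k \<in> carrier_vec n. \<forall>s \<ge> 1.
      h (?p ^ s * l) (?p ^ s \<cdot>\<^sub>v k) - h (?p ^ (s - 1) * l) (?p ^ (s - 1) \<cdot>\<^sub>v k)
        \<in> padic_multiples s) \<longleftrightarrow> ?cong" (is "?L \<longleftrightarrow> _")
  proof
    assume L: ?L
    show ?cong
    proof (intro allI ballI impI)
      fix s l k assume k: "(k :: int vec) \<in> carrier_vec n" and "?p ^ s dvd l"
      then obtain q where "l = ?p ^ s * q" by blast
      then show "h (?p * l) (?p \<cdot>\<^sub>v (?p ^ s \<cdot>\<^sub>v k)) - h l (?p ^ s \<cdot>\<^sub>v k) \<in> padic_multiples (Suc s)"
        using L[rule_format, OF k, of "Suc s" q] by (simp add: smult_smult_assoc mult.assoc)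
    qed
  next
    assume C: ?cong
    show ?L
    proof (intro allI ballI impI)
      fix l s and k :: "int vec" assume k: "k \<in> carrier_vec n" and "(1 :: nat) \<le> s"
      then obtain t where "s = Suc t" by (cases s) auto
      then show "h (?p ^ s * l) (?p ^ s \<cdot>\<^sub>v k) - h (?p ^ (s - 1) * l) (?p ^ (s - 1) \<cdot>\<^sub>v k)
          \<in> padic_multiples s"
        using C[rule_format, OF k, of t "?p ^ t * l"] by (simp add: smult_smult_assoc mult.assoc)
    qed
  qed
  then show ?thesis
    unfolding gauss_congruences_def padic_multiples_def[symmetric]
    unfolding padic_ints_eq_multiples by blast
qed

text \<open>A multiple of p^s in the x-exponent is also a multiple of p^v, so the modulus is
  governed by the smaller divisibility of l.\<close>

lemma gauss_congruencesD:
  fixes h :: "'p :: prime_card padic zx_series"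
  assumes "gauss_congruences n h" "k \<in> carrier_vec n" "int CARD('p) ^ v dvd l" "v \<le> s"
  shows "h (int CARD('p) * l) (int CARD('p) \<cdot>\<^sub>v (int CARD('p) ^ s \<cdot>\<^sub>v k)) - h l (int CARD('p) ^ s \<cdot>\<^sub>v k)
    \<in> padic_multiples (Suc v)"
proof -
  let ?p = "int CARD('p)"
  have "?p ^ s \<cdot>\<^sub>v k = ?p ^ v \<cdot>\<^sub>v (?p ^ (s - v) \<cdot>\<^sub>v k)"
    using assms(4) by (simp add: smult_smult_assoc flip: power_add)
  then show ?thesis
    using assms(1-3) unfolding gauss_congruences_iff by (metis smult_carrier_vec)
qed

text \<open>The difference of products splits into a change of a_l(m) and a change of f. If p^s
  divides l, the latter is settled by the congruence for f alone; otherwise the divisibility of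
  a_l(m) supplies the missing powers.\<close>

lemma gauss_term_cong:
  fixes F :: "'p :: prime_card padic zx_series" and x :: "'p padic fps"
  assumes F: "gauss_congruences n F" and k: "k \<in> carrier_vec n"
    and m: "int CARD('p) ^ s dvd m"
    and x: "fps_to_fls x \<noteq> 0" "fps_to_fls x \<in> fls_multiples 0" "inverse (fps_to_fls x) \<in> fls_multiples 0"
  shows "F (int CARD('p) * l) (int CARD('p) \<cdot>\<^sub>v (int CARD('p) ^ s \<cdot>\<^sub>v k)) *
      twisted_coeff (fps_to_fls x) (int CARD('p) * l) (int CARD('p) * m) -
    F l (int CARD('p) ^ s \<cdot>\<^sub>v k) * twisted_coeff (fps_to_fls x) l m \<in> padic_multiples (Suc s)"
proof -
  let ?p = "int CARD('p)"
  let ?a = "twisted_coeff (fps_to_fls x)"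
  define K where "K = ?p ^ s \<cdot>\<^sub>v k"
  note G = refl x
  have "F (?p * l) (?p \<cdot>\<^sub>v K) \<in> padic_multiples 0"
    using F k by (simp add: gauss_congruences_iff K_def)
  then have 1: "F (?p * l) (?p \<cdot>\<^sub>v K) * (?a (?p * l) (?p * m) - ?a l m) \<in> padic_multiples (0 + Suc s)"
    by (rule padic_multiples_mult) (rule twisted_coeff_cong[OF G m])
  have 2: "(F (?p * l) (?p \<cdot>\<^sub>v K) - F l K) * ?a l m \<in> padic_multiples (Suc s)"
  proof (cases "?p ^ s dvd l")
    case True
    then have "F (?p * l) (?p \<cdot>\<^sub>v K) - F l K \<in> padic_multiples (Suc s)"
      unfolding K_def using gauss_congruencesD[OF F k] by blast
    from padic_multiples_mult[OF this twisted_coeff_multiples_0[OF G]] show ?thesis by simp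
  next
    case False
    then have l: "l \<noteq> 0" by auto
    define v where "v = multiplicity ?p l"
    have v: "v < s" using False multiplicity_dvd'[of s ?p l] by (auto simp: v_def not_le[symmetric])
    have "F (?p * l) (?p \<cdot>\<^sub>v K) - F l K \<in> padic_multiples (Suc v)"
      unfolding K_def using gauss_congruencesD[OF F k, of v] v by (simp add: v_def multiplicity_dvd)
    \<comment> \<open>The exponents add up: (v + 1) + (s - v) = s + 1.\<close>
    from padic_multiples_mult[OF this twisted_coeff_multiples[OF G m l]] show ?thesis
      using v by (simp add: v_def)
  qed
  have "F (?p * l) (?p \<cdot>\<^sub>v K) * ?a (?p * l) (?p * m) - F l K * ?a l m =
      F (?p * l) (?p \<cdot>\<^sub>v K) * (?a (?p * l) (?p * m) - ?a l m) + (F (?p * l) (?p \<cdot>\<^sub>v K) - F l K) * ?a l m"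
    by (simp add: algebra_simps)
  then show ?thesis using padic_multiples_add[OF 1[simplified] 2] by (simp add: K_def)
qed

theorem theorem7p1:
  fixes n r :: nat
    and \<alpha> :: "real vec \<Rightarrow> real"
    and f :: "('p :: prime_card) padic_int zx_series"
    and g :: "'p padic_int fps"
  assumes "linear_form (n + 1) \<alpha>"
    and "\<alpha> (unit_vec (n + 1) 0) > 0"
    and "\<And>l k. (l, k) \<in> supp n f \<Longrightarrow> \<alpha> (real_exponent l k) > 0"
    and "r > 0"
    and "\<exists>u. u dvd 1 \<and> g = fps_X ^ r * u"
    and "gauss_congruences n (\<lambda>l k. to_fract (f l k))"
  shows "gauss_congruences n
    (fls_mult_series (fls_X * fls_deriv (padic_fls g) / padic_fls g)
      (subst_z (\<lambda>l k. to_fract (f l k)) (padic_fls g)))"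
proof -
  let ?p = "int CARD('p)"
  obtain u where u: "u dvd 1" "g = fps_X ^ r * u" using assms(5) by blast
  define x where "x = Abs_fps (\<lambda>i. to_fract (fps_nth g i))"
  define G where "G = padic_fls g"
  define F where "F = (\<lambda>l k. to_fract (f l k))"
  define H where "H = fls_mult_series (fls_log_euler G) (subst_z F G)"
  let ?a = "twisted_coeff G"
  have x: "G = fps_to_fls x" by (simp add: G_def x_def padic_fls_def)
  have sub: "fls_subdegree G = int r" using padic_fls_subdegree[OF u] by (simp add: G_def)
  have "G \<noteq> 0" using sub assms(4) by auto
  then have Gs: "G \<noteq> 0" "G \<in> fls_multiples 0" "inverse G \<in> fls_multiples 0"
    using inverse_padic_fls_multiples[OF u(1), of r] by (simp_all add: G_def u(2) padic_fls_multiples)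
  note Gx = x Gs
  have F: "gauss_congruences n F" using assms(6) by (simp add: F_def)
  have F0: "F l k \<in> padic_multiples 0" if "k \<in> carrier_vec n" for l k
    using F that by (simp add: gauss_congruences_iff)
  \<comment> \<open>Having the formula for all large windows allows windows of different sizes to be
    matched for two coefficients. Below, l is bounded by the support condition; above, by the order
    l r of g^l with r > 0.\<close>
  have H_eq: "\<exists>N0. \<forall>N\<ge>N0. H m k = (\<Sum>l\<in>{-N..N}. F l k * ?a l m)" if k: "k \<in> carrier_vec n" for m k
  proof -
    obtain L where L: "\<And>l. f l k \<noteq> 0 \<Longrightarrow> L \<le> l"
      using supp_lower_bound[OF assms(1-3) k] by blast
    define M where "M = m - fls_subdegree (fls_log_euler G)"
    have "H m k = (\<Sum>l\<in>{-N..N}. F l k * ?a l m)" if N: "N \<ge> max (- L) (max 0 M)" for N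
      unfolding H_def twisted_coeff_def[OF Gx]
    proof (rule fls_mult_series_subst_z_eq_sum)
      fix l j assume "F l k \<noteq> 0" and j: "j \<le> m - fls_subdegree (fls_log_euler G)"
        and "fls_nth (G powi l) j \<noteq> 0"
      then have "L \<le> l" "l * int r \<le> j"
        using L[of l] fls_subdegree_leI[of "G powi l" j] sub by (auto simp: F_def)
      moreover have "l \<le> l * int r" if "l > 0" using that assms(4) by simp
      ultimately have "L \<le> l" "l \<le> max 0 j" by linarith+
      then show "l \<in> {-N..N}" using N j unfolding M_def by auto
    qed simp
    then show ?thesis by blast
  qed
  have "gauss_congruences n H"
    unfolding gauss_congruences_iff
  proof (intro conjI allI ballI impI)
    fix m and k :: "int vec" assume k: "k \<in> carrier_vec n"
    obtain N where "H m k = (\<Sum>l\<in>{-N..N}. F l k * ?a l m)" using H_eq[OF k] by blast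
    moreover have "F l k * ?a l m \<in> padic_multiples (0 + 0)" for l
      by (intro padic_multiples_mult F0 k twisted_coeff_multiples_0[OF Gx])
    ultimately show "H m k \<in> padic_multiples 0" by (simp add: padic_multiples_sum)
  next
    fix s m and k :: "int vec" assume k: "k \<in> carrier_vec n" and m: "?p ^ s dvd m"
    define K where "K = ?p ^ s \<cdot>\<^sub>v k"
    have K: "K \<in> carrier_vec n" "?p \<cdot>\<^sub>v K \<in> carrier_vec n" using k by (simp_all add: K_def)
    obtain N1 where N1: "\<And>N. N \<ge> N1 \<Longrightarrow> H m K = (\<Sum>l\<in>{-N..N}. F l K * ?a l m)"
      using H_eq[OF K(1)] by blast
    obtain N2 where N2: "\<And>N. N \<ge> N2 \<Longrightarrow>
        H (?p * m) (?p \<cdot>\<^sub>v K) = (\<Sum>l\<in>{-N..N}. F l (?p \<cdot>\<^sub>v K) * ?a l (?p * m))"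
      using H_eq[OF K(2)] by blast
    \<comment> \<open>The window [-N, N] serves (m, K) and [-pN, pN] serves (pm, pK); the 0 in the
      maximum ensures that pN is at least N.\<close>
    define N where "N = max 0 (max N1 N2)"
    have p: "?p > 0" by (simp add: zero_less_card_finite)
    have "1 * N \<le> ?p * N" using p by (intro mult_right_mono) (auto simp: N_def)
    then have N: "N \<ge> N1" "?p * N \<ge> N2" by (auto simp: N_def)
    let ?b = "\<lambda>l. F l (?p \<cdot>\<^sub>v K) * ?a l (?p * m)"
    let ?I = "(*) ?p ` {-N..N}"
    have I: "l \<in> ?I" if l: "l \<in> {-(?p * N)..?p * N}" "?p dvd l" for l
    proof -
      obtain q where q: "l = ?p * q" using l(2) by blast
      then have "?p * (- N) \<le> ?p * q" "?p * q \<le> ?p * N" using l(1) by auto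
      then have "q \<in> {-N..N}" using p by (simp only: mult_le_cancel_left_pos atLeastAtMost_iff)
      then show ?thesis using q by blast
    qed
    \<comment> \<open>The large window splits into p times the small one and the indices prime to
      p.\<close>
    have "?I \<subseteq> {-(?p * N)..?p * N}"
      using p by (auto simp: minus_mult_right simp del: mult_minus_right intro!: mult_left_mono)
    then have "H (?p * m) (?p \<cdot>\<^sub>v K) = (\<Sum>l\<in>{-(?p * N)..?p * N} - ?I. ?b l) + (\<Sum>l\<in>?I. ?b l)"
      using N2[OF N(2)] by (simp add: sum.subset_diff)
    also have "(\<Sum>l\<in>?I. ?b l) = (\<Sum>l\<in>{-N..N}. ?b (?p * l))"
      using p by (subst sum.reindex) (auto simp: inj_on_def)
    finally have "H (?p * m) (?p \<cdot>\<^sub>v K) - H m K = (\<Sum>l\<in>{-(?p * N)..?p * N} - ?I. ?b l) +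
        (\<Sum>l\<in>{-N..N}. ?b (?p * l) - F l K * ?a l m)"
      using N1[OF N(1)] by (simp add: sum_subtractf)
    also have "\<dots> \<in> padic_multiples (Suc s)"
    proof (intro padic_multiples_add padic_multiples_sum)
      fix l assume "l \<in> {-(?p * N)..?p * N} - ?I"
      then have l: "\<not> ?p dvd l" using I by blast
      then have "l \<noteq> 0" by auto
      moreover have "?p ^ Suc s dvd ?p * m" using m by simp
      \<comment> \<open>As l is prime to p, it absorbs nothing of the factor p^(s+1) of pm.\<close>
      ultimately have "?a l (?p * m) \<in> padic_multiples (Suc s - multiplicity ?p l)"
        by (intro twisted_coeff_multiples[OF Gx])
      then have "?a l (?p * m) \<in> padic_multiples (Suc s)"
        using l by (simp add: not_dvd_imp_multiplicity_0)
      from padic_multiples_mult[OF F0[OF K(2)] this] show "?b l \<in> padic_multiples (Suc s)" by simp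
    next
      fix l
      show "?b (?p * l) - F l K * ?a l m \<in> padic_multiples (Suc s)"
        using gauss_term_cong[OF F k m, of x l] Gs unfolding K_def x by blast
    qed
    finally show "H (?p * m) (?p \<cdot>\<^sub>v (?p ^ s \<cdot>\<^sub>v k)) - H m (?p ^ s \<cdot>\<^sub>v k) \<in> padic_multiples (Suc s)"
      by (simp add: K_def)
  qed
  then show ?thesis by (simp add: H_def F_def G_def fls_log_euler_def fls_euler_def)
qed

end
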